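(* If $N\le 3$ and $\theta_i=\theta$ for all $i\in[N]$, then $c$ is weakly concave on $\Lambda$.
   Context: Fix an integer $N\ge 1$ and write $[N]=\{1,\dots,N\}$. Costs $c_{(i)}>0$ and $c_{(i,j)}>0$ ($i,j\in[N]$) are given with $c_{(i)}=c_{(i,i)}\le c_{(i,j)}=c_{(j,i)}$ for all $i,j\in[N]$. The parameters $\theta_i>0$ ($i\in[N]$) are given. The domain is the box $\Lambda=[\underline{\boldsymbol{\lambda}},\overline{\boldsymbol{\lambda}}]=\{\boldsymbol{\lambda}\in\mathbb{R}^N:\underline{\lambda}_i\le\lambda_i\le\overline{\lambda}_i\ \forall i\}$ with $\underline{\lambda}_i>0$ for all $i$. For $\boldsymbol{\lambda}\in\Lambda$, $c(\boldsymbol{\lambda})$ is the optimal value of the linear program in variables $\boldsymbol{x}=(x_{i,j})_{i,j\in[N]}$, $\boldsymbol{y}=(y_i)_{i\in[N]}$: minimize $\sum_{i,j\in[N]}c_{(i,j)}x_{i,j}+\sum_{i\in[N]}c_{(i)}y_i$ subject to $\sum_{j\in[N]}x_{j,i}+\sum_{j\in[N]}x_{i,j}+y_i=\lambda_i$ for all $i\in[N]$; $\theta_i x_{i,j}\le\lambda_j y_i$ for all $i,j\in[N]$; $x_{i,j}\ge 0$ for all $i,j\in[N]$; $y_i\ge 0$ for all $i\in[N]$. Weak concavity: $c$ is weakly concave on $\Lambda$ if there exists a finite $\rho\ge 0$ such that $\boldsymbol{\lambda}\mapsto c(\boldsymbol{\lambda})-\rho\|\boldsymbol{\lambda}\|^2/2$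 is concave on $\Lambda$, with $\|\cdot\|$ the Euclidean norm. *)

theory Defs
  imports "HOL-Analysis.Analysis"
begin

definition lp_feasible ::
  "('n \<Rightarrow> real) \<Rightarrow> real ^ 'n \<Rightarrow> (('n::finite \<Rightarrow> 'n \<Rightarrow> real) \<times> ('n \<Rightarrow> real)) set"
  where
  "lp_feasible \<theta> lam = {(x, y).
     (\<forall>i. (\<Sum>j\<in>UNIV. x j i) + (\<Sum>j\<in>UNIV. x i j) + y i = lam $ i) \<and>
     (\<forall>i j. \<theta> i * x i j \<le> lam $ j * y i) \<and>
     (\<forall>i j. 0 \<le> x i j) \<and>
     (\<forall>i. 0 \<le> y i)}"

definition lp_objective ::
  "('n::finite \<Rightarrow> real) \<Rightarrow> ('n \<Rightarrow> 'n \<Rightarrow> real) \<Rightarrow> ('n \<Rightarrow> 'n \<Rightarrow> real) \<times> ('n \<Rightarrow> real) \<Rightarrow> real"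
  where
  "lp_objective c1 c2 = (\<lambda>(x, y).
     (\<Sum>i\<in>UNIV. \<Sum>j\<in>UNIV. c2 i j * x i j) + (\<Sum>i\<in>UNIV. c1 i * y i))"

definition lp_value ::
  "('n::finite \<Rightarrow> real) \<Rightarrow> ('n \<Rightarrow> 'n \<Rightarrow> real) \<Rightarrow> ('n \<Rightarrow> real) \<Rightarrow> real ^ 'n \<Rightarrow> real"
  where
  "lp_value c1 c2 \<theta> lam = (INF z \<in> lp_feasible \<theta> lam. lp_objective c1 c2 z)"

text \<open>
  On the box considered here the infimum is over a nonempty set that is bounded below:
\<close>

lemma lp_feasible_nonempty:
  assumes "\<And>i. 0 \<le> lam $ i"
  shows "(\<lambda>_ _. 0, \<lambda>i. lam $ i) \<in> lp_feasible \<theta> lam"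
  using assms by (simp add: lp_feasible_def)

lemma lp_objective_bdd_below:
  assumes "\<And>i. 0 \<le> c1 i" and "\<And>i j. 0 \<le> c2 i j"
  shows "bdd_below (lp_objective c1 c2 ` lp_feasible \<theta> lam)"
proof (rule bdd_belowI2[where m = 0])
  fix z assume "z \<in> lp_feasible \<theta> lam"
  then show "0 \<le> lp_objective c1 c2 z"
    using assms
    by (auto simp: lp_feasible_def lp_objective_def intro!: add_nonneg_nonneg sum_nonneg mult_nonneg_nonneg)
qed

definition weakly_concave_on :: "'a::real_normed_vector set \<Rightarrow> ('a \<Rightarrow> real) \<Rightarrow> bool"
  where
  "weakly_concave_on S f \<longleftrightarrow> (\<exists>\<rho>\<ge>0. concave_on S (\<lambda>v. f v - \<rho> * (norm v)\<^sup>2 / 2))"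

end

theory Submission imports Defs
begin

text \<open>
  Substitute $x_{ij} = \lambda_i \lambda_j u_{ij}$, $y_i = \lambda_i v_i$, $\mu_j = \lambda_j / \theta$ and
  $r_{ij} = c_i + c_j - c_{ij}$. The constraints become $\theta u_{ij} \le v_i$, so a basis amounts to a
  graph $E$ (with loops) of saturated pairs, on which $v$ solves
  $v_i + \sum_{j \sim i} \mu_j (v_i + v_j) = 1$. After weighting row $i$ by $\mu_i$ this system is symmetric
  positive definite (a signless Laplacian plus a diagonal), so $v$ is Lipschitz in $\lambda$ on the box.

  The dual prices solve $Q_i = \sum_j \mu_j (r_{ij} - Q_i - Q_j)^+$, and $E$ consists of the pairs with
  $Q_i + Q_j \le r_{ij}$. For $N \le 3$ all loops belong to $E$, and a graph with all loops has $v \ge 0$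
  for every $\lambda$. Hence the graph that is optimal at $\lambda^0$ yields a feasible point at every $\lambda$
  of the box; pricing it with the $Q$ of $\lambda^0$ shows that its cost lies above $c(\lambda^0)$ by at most an
  affine term plus $O(\|\lambda - \lambda^0\|^2)$. Such a quadratic support from above at each point
  is weak concavity.
\<close>

section \<open>Concavity from quadratic supports\<close>

text \<open>Subtracting \<open>\<rho> * (norm v)\<^sup>2 / 2\<close> cancels the quadratic term and
  leaves an affine majorant of slope \<open>g - \<rho> *\<^sub>R x\<close> touching at
  \<open>x\<close>. The majorant touching at a convex combination, averaged over the two endpoints,
  gives concavity.\<close>

lemma concave_on_of_quadratic_support:
  fixes f :: "'a::real_inner \<Rightarrow> real"
  assumes "convex S"
    and "\<And>x. x \<in> S \<Longrightarrow> \<exists>g. \<forall>y\<in>S. f y \<le> f x + g \<bullet> (y - x) + \<rho> * (norm (y - x))\<^sup>2 / 2"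
  shows "concave_on S (\<lambda>v. f v - \<rho> * (norm v)\<^sup>2 / 2)"
  unfolding concave_on_iff
proof (intro conjI ballI allI impI)
  fix a b :: 'a and s t :: real
  assume S: "a \<in> S" "b \<in> S" and st: "0 \<le> s" "0 \<le> t" "s + t = 1"
  define z where "z = s *\<^sub>R a + t *\<^sub>R b"
  define F where "F v = f v - \<rho> * (norm v)\<^sup>2 / 2" for v
  have "z \<in> S"
    using \<open>convex S\<close> S st by (simp add: z_def convex_def)
  then obtain g where g: "\<And>y. y \<in> S \<Longrightarrow> f y \<le> f z + g \<bullet> (y - z) + \<rho> * (norm (y - z))\<^sup>2 / 2"
    using assms(2) by blast
  have support: "F y \<le> F z + (g - \<rho> *\<^sub>R z) \<bullet> (y - z)" if "y \<in> S" for y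
    using g[OF that] unfolding F_def
    by (simp add: power2_norm_eq_inner inner_diff inner_commute algebra_simps add_divide_distrib diff_divide_distrib)
  have "s * F a + t * F b \<le> s * (F z + (g - \<rho> *\<^sub>R z) \<bullet> (a - z)) + t * (F z + (g - \<rho> *\<^sub>R z) \<bullet> (b - z))"
    using support S st by (intro add_mono mult_left_mono) auto
  also have "\<dots> = (s + t) * F z + (g - \<rho> *\<^sub>R z) \<bullet> (z - (s + t) *\<^sub>R z)"
    by (simp add: z_def inner_diff_right inner_add_right algebra_simps)
  finally show "s * (f a - \<rho> * (norm a)\<^sup>2 / 2) + t * (f b - \<rho> * (norm b)\<^sup>2 / 2)
      \<le> f (s *\<^sub>R a + t *\<^sub>R b) - \<rho> * (norm (s *\<^sub>R a + t *\<^sub>R b))\<^sup>2 / 2"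
    using st by (simp add: F_def z_def)
qed (fact \<open>convex S\<close>)

section \<open>The saturated linear system\<close>

text \<open>The matrix of the saturated system; row $i$ is the balance constraint of $i$ divided by $\lambda_i$.\<close>

definition sat_op :: "('n::finite \<Rightarrow> 'n \<Rightarrow> bool) \<Rightarrow> ('n \<Rightarrow> real) \<Rightarrow> ('n \<Rightarrow> real) \<Rightarrow> 'n \<Rightarrow> real"
  where "sat_op E \<mu> v i = v i + (\<Sum>j\<in>UNIV. of_bool (E i j) * (\<mu> j * (v i + v j)))"

text \<open>When row \<open>i\<close> is paired with \<open>\<mu> i * v i\<close>, symmetry of
  \<open>E\<close> turns the edge part into half of a weighted sum of squares
  \<open>(v i + v j)\<^sup>2\<close>. Both solvability and the bound on the inverse come from this
  inequality.\<close>

lemma sat_op_energy: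
  assumes "symp E" and "\<And>i. 0 \<le> \<mu> i"
  shows "(\<Sum>i\<in>UNIV. \<mu> i * (v i)\<^sup>2) \<le> (\<Sum>i\<in>UNIV. \<mu> i * v i * sat_op E \<mu> v i)"
proof -
  define a where "a i j = (of_bool (E i j) :: real)" for i j
  have sym: "a i j = a j i" for i j
    using \<open>symp E\<close> by (auto simp: a_def symp_def)
  define X where "X = (\<Sum>i\<in>UNIV. \<Sum>j\<in>UNIV. a i j * \<mu> i * \<mu> j * (v i * (v i + v j)))"
  have "X = (\<Sum>i\<in>UNIV. \<Sum>j\<in>UNIV. a i j * \<mu> i * \<mu> j * (v j * (v i + v j)))"
    unfolding X_def by (subst sum.swap) (simp add: sym[of _ "_"] mult_ac add_ac cong: sum.cong)
  then have "X + X = (\<Sum>i\<in>UNIV. \<Sum>j\<in>UNIV. a i j * \<mu> i * \<mu> j * (v i * (v i + v j)))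
      + (\<Sum>i\<in>UNIV. \<Sum>j\<in>UNIV. a i j * \<mu> i * \<mu> j * (v j * (v i + v j)))"
    by (simp add: X_def)
  also have "\<dots> = (\<Sum>i\<in>UNIV. \<Sum>j\<in>UNIV. a i j * \<mu> i * \<mu> j * (v i + v j)\<^sup>2)"
    unfolding sum.distrib[symmetric] by (simp add: power2_eq_square algebra_simps)
  also have "\<dots> \<ge> 0"
    using assms(2) by (intro sum_nonneg mult_nonneg_nonneg) (auto simp: a_def)
  finally have "0 \<le> X" by simp
  moreover have "(\<Sum>i\<in>UNIV. \<mu> i * v i * sat_op E \<mu> v i) = (\<Sum>i\<in>UNIV. \<mu> i * (v i)\<^sup>2) + X"
    unfolding X_def sat_op_def a_def
    by (simp add: sum.distrib sum_distrib_left power2_eq_square algebra_simps)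
  ultimately show ?thesis by simp
qed

text \<open>The energy inequality makes the kernel trivial, and an injective endomorphism of a
  finite-dimensional space is onto.\<close>

lemma sat_op_solvable:
  assumes "symp E" and "\<And>i. 0 < \<mu> i"
  shows "\<exists>v. \<forall>i. sat_op E \<mu> v i = b i"
proof -
  define T :: "real^'a \<Rightarrow> real^'a" where "T u = (\<chi> i. sat_op E \<mu> (\<lambda>i. u $ i) i)" for u
  have "linear T"
    by (rule linearI)
      (simp_all add: T_def sat_op_def vec_eq_iff sum.distrib[symmetric] sum_distrib_left algebra_simps)
  moreover have "inj T"
  proof (rule linear_injective_0[THEN iffD2, OF \<open>linear T\<close>, rule_format])
    fix u assume "T u = 0"
    then have "sat_op E \<mu> (($) u) i = 0" for i
      by (simp add: T_def vec_eq_iff)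
    then have "(\<Sum>i\<in>UNIV. \<mu> i * (u $ i)\<^sup>2) \<le> 0"
      using sat_op_energy[of E \<mu> "($) u"] assms by (simp add: less_imp_le)
    then have "\<forall>i. \<mu> i * (u $ i)\<^sup>2 = 0"
      using assms(2) sum_nonneg_eq_0_iff[of UNIV "\<lambda>i. \<mu> i * (u $ i)\<^sup>2"]
      by (metis (no_types, lifting) UNIV_I antisym finite less_imp_le mult_nonneg_nonneg sum_nonneg zero_le_power2)
    then show "u = 0"
      using assms(2) by (auto simp: vec_eq_iff) (metis less_irrefl)
  qed
  ultimately have "surj T"
    by (rule linear_injective_imp_surjective) simp
  then obtain u where "(\<chi> i. b i) = T u" by (rule surjE)
  then show ?thesis
    by (intro exI[of _ "($) u"]) (simp add: T_def vec_eq_iff)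
qed

text \<open>This makes the saturated point primal feasible. Every positive \<open>\<mu>\<close> has
  to be covered, because the graph found at one point of the box is reused at all others.\<close>

lemma sat_op_nonneg:
  fixes E :: "'n::finite \<Rightarrow> 'n \<Rightarrow> bool"
  assumes "reflp E" "symp E" and \<mu>: "\<And>i. 0 < \<mu> i" and card: "CARD('n) \<le> 3"
    and v: "\<And>i. sat_op E \<mu> v i = 1"
  shows "0 \<le> v i"
proof (rule ccontr)
  assume neg: "\<not> 0 \<le> v i"
  define m where "m = arg_min_on v UNIV"
  have min: "v m \<le> v j" for j
    unfolding m_def by (rule arg_min_least) auto
  \<comment> \<open>Each neighbour contributes at most 1/2 to row \<open>m\<close>, by its own loop; with at most two of
    them, row \<open>m\<close> cannot sum to 1.\<close>
  then have "v m < 0" using neg by (meson not_less le_less_trans)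
  define t where "t i j = (of_bool (E i j) * (\<mu> j * (v i + v j)))" for i j
  have row: "v i + t i i + (\<Sum>j\<in>UNIV - {i}. t i j) = 1" for i
    using v[of i] unfolding sat_op_def t_def by (subst (asm) sum.remove[of UNIV i]) auto
  have loop: "t i i = 2 * \<mu> i * v i" for i
    using \<open>reflp E\<close> by (simp add: t_def reflpD)
  have "t m j \<le> 1/2" if "j \<noteq> m" for j
  proof (cases "E m j \<and> 0 < v m + v j")
    case False
    then have "t m j \<le> 0"
      using \<mu>[of j] by (auto simp: t_def not_less intro: mult_nonneg_nonpos)
    then show ?thesis by simp
  next
    case True
    \<comment> \<open>\<open>v j + v k\<close> is at least \<open>v j + v m\<close>, hence positive,
      so row \<open>j\<close> has no negative edge term and can be cut down to its diagonal and
      loop.\<close>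
    have "0 \<le> t j k" for k
      using True min[of k] \<mu>[of k] by (auto simp: t_def intro!: mult_nonneg_nonneg)
    then have "(1 + 2 * \<mu> j) * v j \<le> 1"
      using row[of j] sum_nonneg[of "UNIV - {j}" "t j"] by (simp add: loop algebra_simps)
    moreover have "0 < v j" using True \<open>v m < 0\<close> by simp
    ultimately have "\<mu> j * v j \<le> 1/2" by (simp add: algebra_simps)
    moreover have "\<mu> j * (v m + v j) \<le> \<mu> j * v j"
      using \<mu>[of j] \<open>v m < 0\<close> by (simp add: mult_left_mono)
    ultimately show ?thesis using True by (simp add: t_def)
  qed
  then have "(\<Sum>j\<in>UNIV - {m}. t m j) \<le> (\<Sum>j\<in>UNIV - {m}. 1/2)"
    by (intro sum_mono) auto
  also have "\<dots> \<le> 1"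
    using card by (simp add: card_Diff_singleton)
  finally have "0 \<le> (1 + 2 * \<mu> m) * v m"
    using row[of m] by (simp add: loop algebra_simps)
  moreover have "(1 + 2 * \<mu> m) * v m < 0"
    using \<mu>[of m] \<open>v m < 0\<close> by (simp add: mult_pos_neg)
  ultimately show False by simp
qed

lemma sat_op_le_one:
  assumes \<mu>: "\<And>i. 0 \<le> \<mu> i" and nonneg: "\<And>i. 0 \<le> v i" and v: "sat_op E \<mu> v i = 1"
  shows "v i \<le> 1"
proof -
  have "0 \<le> (\<Sum>j\<in>UNIV. of_bool (E i j) * (\<mu> j * (v i + v j)))"
    by (intro sum_nonneg mult_nonneg_nonneg add_nonneg_nonneg \<mu> nonneg) auto
  then show ?thesis using v by (simp add: sat_op_def)
qed

text \<open>Young's inequality absorbs half of the energy \<open>S\<close> and bounds the rest by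
  \<open>H\<close>; comparing \<open>S\<close> with \<open>a * (u i)\<^sup>2\<close> then produces
  the square root.\<close>

lemma sat_op_inverse_bound:
  fixes E :: "'n::finite \<Rightarrow> 'n \<Rightarrow> bool" and a b :: real
  assumes "symp E" and \<mu>: "\<And>i. a \<le> \<mu> i" "\<And>i. \<mu> i \<le> b" and "0 < a"
    and h: "\<And>i. \<bar>sat_op E \<mu> u i\<bar> \<le> H"
  shows "\<bar>u i\<bar> \<le> sqrt (CARD('n) * b / a) * H"
proof -
  have pos: "0 \<le> \<mu> i" for i using \<mu>(1)[of i] \<open>0 < a\<close> by simp
  have "0 \<le> H" using h[of i] by simp
  define S where "S = (\<Sum>i\<in>UNIV. \<mu> i * (u i)\<^sup>2)"
  have "S \<le> (\<Sum>i\<in>UNIV. \<mu> i * u i * sat_op E \<mu> u i)"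
    unfolding S_def by (rule sat_op_energy[OF \<open>symp E\<close> pos])
  also have "\<dots> \<le> (\<Sum>i\<in>UNIV. \<mu> i * ((u i)\<^sup>2 / 2 + H\<^sup>2 / 2))"
  proof (rule sum_mono)
    fix i
    have "(sat_op E \<mu> u i)\<^sup>2 \<le> H\<^sup>2"
      using h[of i] by (simp add: abs_le_square_iff[symmetric] \<open>0 \<le> H\<close>)
    moreover have "0 \<le> (u i - sat_op E \<mu> u i)\<^sup>2" by simp
    ultimately have "u i * sat_op E \<mu> u i \<le> (u i)\<^sup>2 / 2 + H\<^sup>2 / 2"
      by (simp add: power2_diff)
    then show "\<mu> i * u i * sat_op E \<mu> u i \<le> \<mu> i * ((u i)\<^sup>2 / 2 + H\<^sup>2 / 2)"
      using mult_left_mono[OF _ pos[of i]] by (simp add: mult.assoc)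
  qed
  also have "\<dots> = S / 2 + (\<Sum>i\<in>UNIV. \<mu> i) * H\<^sup>2 / 2"
    by (simp add: S_def sum.distrib sum_distrib_right sum_divide_distrib algebra_simps)
  also have "(\<Sum>i\<in>UNIV. \<mu> i) * H\<^sup>2 / 2 \<le> (CARD('n) * b) * H\<^sup>2 / 2"
    using sum_bounded_above[of UNIV \<mu> b] \<mu>(2) by (intro divide_right_mono mult_right_mono) auto
  finally have "S \<le> CARD('n) * b * H\<^sup>2" by simp
  moreover have "a * (u i)\<^sup>2 \<le> S"
  proof -
    have "a * (u i)\<^sup>2 \<le> \<mu> i * (u i)\<^sup>2" by (simp add: mult_right_mono \<mu>(1))
    also have "\<dots> \<le> S"
      unfolding S_def by (rule member_le_sum) (auto simp: pos)
    finally show ?thesis .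
  qed
  ultimately have "(u i)\<^sup>2 \<le> CARD('n) * b / a * H\<^sup>2"
    using \<open>0 < a\<close> by (simp add: field_simps)
  then have "sqrt ((u i)\<^sup>2) \<le> sqrt (CARD('n) * b / a * H\<^sup>2)"
    by (rule real_sqrt_le_mono)
  then show ?thesis
    using \<open>0 \<le> H\<close> by (simp only: real_sqrt_mult real_sqrt_abs abs_of_nonneg)
qed

text \<open>At \<open>\<mu>\<close>, the vector \<open>v - w\<close> solves the system whose right
  side is the change of the operator from \<open>\<mu>\<close> to \<open>\<mu>'\<close>, applied to
  \<open>w\<close>. As \<open>w\<close> lies between 0 and 1, each summand there is at most
  \<open>2 * d\<close>.\<close>

lemma sat_op_solution_Lipschitz:
  fixes E :: "'n::finite \<Rightarrow> 'n \<Rightarrow> bool" and a b d :: real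
  assumes "symp E" and \<mu>: "\<And>i. a \<le> \<mu> i" "\<And>i. \<mu> i \<le> b" and "0 < a"
    and w: "\<And>i. sat_op E \<mu>' w i = 1" "\<And>i. 0 \<le> w i" "\<And>i. w i \<le> 1"
    and v: "\<And>i. sat_op E \<mu> v i = 1"
    and d: "\<And>i. \<bar>\<mu> i - \<mu>' i\<bar> \<le> d"
  shows "\<bar>v i - w i\<bar> \<le> sqrt (CARD('n) * b / a) * (2 * CARD('n) * d)"
proof (rule sat_op_inverse_bound[OF \<open>symp E\<close> \<mu> \<open>0 < a\<close>])
  fix i
  have "sat_op E \<mu> (\<lambda>i. v i - w i) i = sat_op E \<mu> v i - sat_op E \<mu> w i"
    by (simp add: sat_op_def right_diff_distrib distrib_left sum_subtractf sum.distrib)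
  also have "\<dots> = sat_op E \<mu>' w i - sat_op E \<mu> w i"
    by (simp add: v w)
  also have "\<dots> = (\<Sum>j\<in>UNIV. of_bool (E i j) * ((\<mu>' j - \<mu> j) * (w i + w j)))"
    by (simp add: sat_op_def sum_subtractf[symmetric] algebra_simps)
  finally have "\<bar>sat_op E \<mu> (\<lambda>i. v i - w i) i\<bar> \<le> (\<Sum>j\<in>UNIV. \<bar>of_bool (E i j) * ((\<mu>' j - \<mu> j) * (w i + w j))\<bar>)"
    using sum_abs by metis
  also have "\<dots> \<le> (\<Sum>j\<in>(UNIV::'n set). d * 2)"
  proof (rule sum_mono)
    fix j
    have "\<bar>(\<mu>' j - \<mu> j) * (w i + w j)\<bar> \<le> d * 2"
      unfolding abs_mult using d[of j] w(2,3)[of i] w(2,3)[of j] by (intro mult_mono) auto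
    then show "\<bar>of_bool (E i j) * ((\<mu>' j - \<mu> j) * (w i + w j))\<bar> \<le> d * 2"
      by (cases "E i j") auto
  qed
  finally show "\<bar>sat_op E \<mu> (\<lambda>i. v i - w i) i\<bar> \<le> 2 * CARD('n) * d" by simp
qed

section \<open>Equilibrium prices\<close>

text \<open>The right side decreases in \<open>Q\<close>, so it maps the box from 0 to its value at
  \<open>Q = 0\<close> into itself, and Brouwer's theorem applies.\<close>

lemma price_equilibrium_exists:
  fixes \<mu> :: "'n::finite \<Rightarrow> real"
  assumes \<mu>: "\<And>i. 0 \<le> \<mu> i"
  shows "\<exists>Q. \<forall>i. Q i = (\<Sum>j\<in>UNIV. \<mu> j * max 0 (r i j - Q i - Q j))"
proof -
  define F :: "real^'n \<Rightarrow> real^'n"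
    where "F q = (\<chi> i. \<Sum>j\<in>UNIV. \<mu> j * max 0 (r i j - q $ i - q $ j))" for q
  define B :: "real^'n" where "B = (\<chi> i. \<Sum>j\<in>UNIV. \<mu> j * max 0 (r i j))"
  have "0 \<le> B $ i" for i
    by (auto simp: B_def intro!: sum_nonneg mult_nonneg_nonneg \<mu>)
  then have "cbox 0 B \<noteq> {}"
    by (auto simp: interval_ne_empty_cart)
  moreover have "continuous_on (cbox 0 B) F"
    unfolding F_def by (intro continuous_intros)
  moreover have "F \<in> cbox 0 B \<rightarrow> cbox 0 B"
    by (auto simp: F_def B_def mem_box_cart intro!: sum_nonneg sum_mono mult_nonneg_nonneg mult_left_mono \<mu>)
       (smt (verit))
  ultimately obtain q where "F q = q"
    using brouwer[of "cbox 0 B" F] by auto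
  then show ?thesis
    by (intro exI[of _ "($) q"]) (simp add: F_def vec_eq_iff)
qed

text \<open>As \<open>r i i = c i\<close>, the claim says that all loops are saturated. If it failed
  at \<open>i\<close>, the loop would add nothing to \<open>Q i\<close>, and at most two other terms
  of size at most \<open>c i / 4\<close> would remain.\<close>

lemma price_equilibrium_le_half:
  fixes c :: "'n::finite \<Rightarrow> real"
  assumes \<mu>: "\<And>i. 0 < \<mu> i" and card: "CARD('n) \<le> 3" and c: "\<And>i. 0 < c i"
    and r: "\<And>i j. r i j \<le> c i" "\<And>i j. r i j \<le> c j" "\<And>i. r i i = c i"
    and Q: "\<And>i. Q i = (\<Sum>j\<in>UNIV. \<mu> j * max 0 (r i j - Q i - Q j))"
  shows "2 * Q i \<le> c i"
proof (rule ccontr)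
  assume "\<not> 2 * Q i \<le> c i"
  then have i: "c i < 2 * Q i" by simp
  \<comment> \<open>The loop at \<open>j\<close> forces \<open>Q j \<ge> \<mu> j * c j / (1 + 2 * \<mu> j)\<close>, which limits what \<open>j\<close> pays to \<open>i\<close>.\<close>
  have bound: "\<mu> j * max 0 (r i j - Q i - Q j) \<le> c i / 4" for j
  proof (cases "0 < r i j - Q i - Q j")
    case False
    then show ?thesis using c[of i] by simp
  next
    case True
    have "\<mu> j * (c j - 2 * Q j) \<le> \<mu> j * max 0 (r j j - Q j - Q j)"
      using \<mu>[of j] r(3)[of j] by (intro mult_left_mono) auto
    \<comment> \<open>The loop term is one of the nonnegative summands in the equation for
      \<open>Q j\<close>; only the right-hand \<open>Q j\<close> is unfolded.\<close>
    also have "\<dots> \<le> Q j"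
      by (subst (3) Q, rule member_le_sum) (auto intro: mult_nonneg_nonneg less_imp_le[OF \<mu>])
    finally have "\<mu> j * c j \<le> (1 + 2 * \<mu> j) * Q j" by (simp add: algebra_simps)
    moreover have "\<mu> j * r i j \<le> \<mu> j * c j" using \<mu>[of j] r(2) by simp
    moreover have "(1 + \<mu> j) * r i j \<le> (1 + \<mu> j) * c i"
      using \<mu>[of j] r(1)[of i j] by (intro mult_left_mono) auto
    moreover have "(1 + 2 * \<mu> j) * c i \<le> (1 + 2 * \<mu> j) * (2 * Q i)"
      using \<mu>[of j] i by (intro mult_left_mono) auto
    \<comment> \<open>Split \<open>(1 + 2 * \<mu> j) * r i j\<close> into
      \<open>\<mu> j * r i j\<close>, absorbed by \<open>Q j\<close>, and
      \<open>(1 + \<mu> j) * r i j\<close>, bounded through \<open>c i\<close>; the term with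
      \<open>Q i\<close> removes all but \<open>c i / 2\<close>.\<close>
    ultimately have "(1 + 2 * \<mu> j) * (r i j - Q i - Q j) \<le> c i / 2"
      by (simp add: algebra_simps)
    with True \<mu>[of j] show ?thesis by (simp add: algebra_simps)
  qed
  have "Q i = (\<Sum>j\<in>UNIV - {i}. \<mu> j * max 0 (r i j - Q i - Q j))"
    using i by (subst (1) Q, subst sum.remove[of UNIV i]) (auto simp: r(3))
  also have "\<dots> \<le> (\<Sum>j\<in>UNIV - {i}. c i / 4)"
    by (intro sum_mono bound)
  also have "\<dots> \<le> 2 * (c i / 4)"
    using card c[of i] by (simp add: card_Diff_singleton mult_right_mono)
  finally show False using i by simp
qed

section \<open>Duality and the saturated point of the linear program\<close>

text \<open>The balance constraints are paired with arbitrary multipliers. Taking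
  \<open>k i = c1 i - Q i\<close> serves both weak duality and the cost of the saturated
  point.\<close>

lemma lp_feasible_price_sum:
  fixes k :: "'n::finite \<Rightarrow> real"
  assumes "(x, y) \<in> lp_feasible \<theta> lam"
  shows "(\<Sum>i\<in>UNIV. lam $ i * k i) = (\<Sum>i\<in>UNIV. \<Sum>j\<in>UNIV. x i j * (k i + k j)) + (\<Sum>i\<in>UNIV. y i * k i)"
proof -
  have bal: "(\<Sum>j\<in>UNIV. x j i) + (\<Sum>j\<in>UNIV. x i j) + y i = lam $ i" for i
    using assms by (auto simp: lp_feasible_def)
  have "(\<Sum>i\<in>UNIV. lam $ i * k i)
      = (\<Sum>i\<in>UNIV. \<Sum>j\<in>UNIV. x j i * k i) + (\<Sum>i\<in>UNIV. \<Sum>j\<in>UNIV. x i j * k i) + (\<Sum>i\<in>UNIV. y i * k i)"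
    by (simp add: bal[symmetric] distrib_right sum.distrib sum_distrib_right)
  also have "(\<Sum>i\<in>UNIV. \<Sum>j\<in>UNIV. x j i * k i) = (\<Sum>i\<in>UNIV. \<Sum>j\<in>UNIV. x i j * k j)"
    by (rule sum.swap)
  finally show ?thesis
    by (simp add: distrib_left sum.distrib)
qed

text \<open>
  Weak duality: \<open>max 0 (c1 i + c1 j - c2 i j - Q i - Q j)\<close> is, up to scaling, the multiplier of
  the capacity constraint of \<open>(i, j)\<close>, and \<open>c1 i - Q i\<close> that of the balance constraint of \<open>i\<close>.
\<close>

lemma lp_objective_ge_price:
  fixes c1 :: "'n::finite \<Rightarrow> real"
  assumes "0 < \<theta>0" and feas: "(x, y) \<in> lp_feasible (\<lambda>_. \<theta>0) lam"
    and Q: "\<And>i. Q i = (\<Sum>j\<in>UNIV. lam $ j / \<theta>0 * max 0 (c1 i + c1 j - c2 i j - Q i - Q j))"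
  shows "(\<Sum>i\<in>UNIV. lam $ i * (c1 i - Q i)) \<le> lp_objective c1 c2 (x, y)"
proof -
  define t where "t i j = max 0 (c1 i + c1 j - c2 i j - Q i - Q j)" for i j
  have cap: "\<theta>0 * x i j \<le> lam $ j * y i" and nonneg: "0 \<le> x i j" for i j
    using feas by (auto simp: lp_feasible_def)
  have Qt: "(\<Sum>j\<in>UNIV. lam $ j / \<theta>0 * t i j) = Q i" for i
    using Q[of i] by (simp add: t_def)
  have "(\<Sum>i\<in>UNIV. y i * (c1 i - Q i))
      = (\<Sum>i\<in>UNIV. c1 i * y i) - (\<Sum>i\<in>UNIV. \<Sum>j\<in>UNIV. lam $ j / \<theta>0 * t i j * y i)"
    unfolding sum_distrib_right[symmetric] Qt by (simp add: sum_subtractf algebra_simps)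
  then have "(\<Sum>i\<in>UNIV. lam $ i * (c1 i - Q i))
      = (\<Sum>i\<in>UNIV. \<Sum>j\<in>UNIV. x i j * ((c1 i - Q i) + (c1 j - Q j)) - lam $ j / \<theta>0 * t i j * y i)
        + (\<Sum>i\<in>UNIV. c1 i * y i)"
    unfolding lp_feasible_price_sum[OF feas] sum_subtractf by simp
  also have "\<dots> \<le> (\<Sum>i\<in>UNIV. \<Sum>j\<in>UNIV. c2 i j * x i j) + (\<Sum>i\<in>UNIV. c1 i * y i)"
  proof (intro add_right_mono sum_mono)
    fix i j
    have "x i j \<le> lam $ j / \<theta>0 * y i"
      using cap[of i j] \<open>0 < \<theta>0\<close> by (simp add: field_simps)
    then have "t i j * x i j \<le> t i j * (lam $ j / \<theta>0 * y i)"
      by (intro mult_left_mono) (auto simp: t_def)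
    moreover have "(c1 i + c1 j - c2 i j - Q i - Q j) * x i j \<le> t i j * x i j"
      using nonneg by (intro mult_right_mono) (auto simp: t_def)
    ultimately show "x i j * ((c1 i - Q i) + (c1 j - Q j)) - lam $ j / \<theta>0 * t i j * y i \<le> c2 i j * x i j"
      by (simp add: algebra_simps)
  qed
  finally show ?thesis by (simp add: lp_objective_def)
qed

text \<open>Balance at \<open>i\<close> is \<open>lam $ i\<close> times row \<open>i\<close> of the
  saturated system; capacity is tight on \<open>E\<close>, and \<open>x\<close> vanishes off
  \<open>E\<close>.\<close>

lemma saturated_feasible:
  fixes E :: "'n::finite \<Rightarrow> 'n \<Rightarrow> bool"
  assumes "0 < \<theta>0" "symp E" and lam: "\<And>i. 0 \<le> lam $ i" and nonneg: "\<And>i. 0 \<le> v i"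
    and v: "\<And>i. sat_op E (\<lambda>i. lam $ i / \<theta>0) v i = 1"
  shows "(\<lambda>i j. of_bool (E i j) * (lam $ i * lam $ j * v i / \<theta>0), \<lambda>i. lam $ i * v i)
    \<in> lp_feasible (\<lambda>_. \<theta>0) lam"
proof -
  have sym: "E j i = E i j" for i j
    using \<open>symp E\<close> by (auto simp: symp_def)
  have "lam $ i * sat_op E (\<lambda>i. lam $ i / \<theta>0) v i =
      (\<Sum>j\<in>UNIV. of_bool (E i j) * (lam $ j * lam $ i * v j / \<theta>0))
      + (\<Sum>j\<in>UNIV. of_bool (E i j) * (lam $ i * lam $ j * v i / \<theta>0)) + lam $ i * v i" for i
    unfolding sat_op_def
    by (simp add: distrib_left sum_distrib_left sum.distrib[symmetric])
       (simp add: add_divide_distrib algebra_simps)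
  then show ?thesis
    using assms(1) by (auto simp: lp_feasible_def v sym of_bool_def intro!: mult_nonneg_nonneg divide_nonneg_pos lam nonneg)
qed


text \<open>On \<open>E\<close> the maximum equals its second argument, and off \<open>E\<close>
  both it and \<open>x\<close> vanish. The cost thus differs from the price sum only by the residual
  of the price equation, weighted by \<open>y\<close>.\<close>

lemma saturated_objective:
  fixes c1 :: "'n::finite \<Rightarrow> real"
  assumes feas: "(\<lambda>i j. of_bool (E i j) * (lam $ i * lam $ j * v i / \<theta>0), \<lambda>i. lam $ i * v i)
      \<in> lp_feasible \<theta> lam" (is "(?x, ?y) \<in> _")
    and E: "\<And>i j. E i j \<longleftrightarrow> 0 \<le> c1 i + c1 j - c2 i j - Q i - Q j"
  shows "lp_objective c1 c2 (?x, ?y) = (\<Sum>i\<in>UNIV. lam $ i * (c1 i - Q i))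
    - (\<Sum>i\<in>UNIV. lam $ i * v i * ((\<Sum>j\<in>UNIV. lam $ j / \<theta>0 * max 0 (c1 i + c1 j - c2 i j - Q i - Q j)) - Q i))"
proof -
  define t where "t i j = max 0 (c1 i + c1 j - c2 i j - Q i - Q j)" for i j
  have "c2 i j * ?x i j = ?x i j * ((c1 i - Q i) + (c1 j - Q j)) - lam $ i * v i * (lam $ j / \<theta>0 * t i j)" for i j
    by (cases "E i j") (use E[of i j] in \<open>auto simp: t_def max_def algebra_simps diff_divide_distrib add_divide_distrib\<close>)
  then have "(\<Sum>i\<in>UNIV. \<Sum>j\<in>UNIV. c2 i j * ?x i j)
      = (\<Sum>i\<in>UNIV. \<Sum>j\<in>UNIV. ?x i j * ((c1 i - Q i) + (c1 j - Q j)))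
        - (\<Sum>i\<in>UNIV. lam $ i * v i * (\<Sum>j\<in>UNIV. lam $ j / \<theta>0 * t i j))"
    by (simp only: sum_subtractf sum_distrib_left)
  moreover have "(\<Sum>i\<in>UNIV. c1 i * ?y i) = (\<Sum>i\<in>UNIV. ?y i * (c1 i - Q i)) + (\<Sum>i\<in>UNIV. lam $ i * v i * Q i)"
    by (simp add: sum.distrib[symmetric] algebra_simps)
  ultimately show ?thesis
    unfolding lp_objective_def lp_feasible_price_sum[OF feas] t_def[symmetric]
    by (simp only: prod.case right_diff_distrib sum_subtractf)
qed

section \<open>Quadratic support of the optimal value\<close>

text \<open>With \<open>Q\<close> and \<open>E\<close> frozen at \<open>lam0\<close>, the price
  residual is linear in \<open>lam - lam0\<close>. Replacing its weights
  \<open>lam $ i * v i\<close> by their values at \<open>lam0\<close> leaves an affine bound, with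
  an error that is a product of two first-order terms. \<open>L\<close> is the Lipschitz constant of
  \<open>v\<close>, and \<open>sum c1 UNIV\<close> bounds the excesses \<open>t i j\<close>.\<close>

lemma lp_value_quadratic_support:
  fixes c1 :: "'n::finite \<Rightarrow> real" and lam0 :: "real^'n" and a b :: real
  assumes c1: "\<And>i. 0 < c1 i" and c2: "\<And>i. c2 i i = c1 i" "\<And>i j. c1 i \<le> c2 i j" "\<And>i j. c2 i j = c2 j i"
    and "0 < \<theta>0" and card: "CARD('n) \<le> 3"
    and "0 < a" and lam0: "\<And>i. a \<le> lam0 $ i" "\<And>i. lam0 $ i \<le> b"
  defines "L \<equiv> sqrt (CARD('n) * (b / \<theta>0) / (a / \<theta>0)) * (2 * CARD('n) / \<theta>0)"
  defines "\<rho> \<equiv> 2 * ((CARD('n))\<^sup>2 * (b * L + 1) * sum c1 UNIV / \<theta>0)"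
  shows "\<exists>g. \<forall>lam. (\<forall>i. a \<le> lam $ i \<and> lam $ i \<le> b) \<longrightarrow>
    lp_value c1 c2 (\<lambda>_. \<theta>0) lam
      \<le> lp_value c1 c2 (\<lambda>_. \<theta>0) lam0 + g \<bullet> (lam - lam0) + \<rho> * (norm (lam - lam0))\<^sup>2 / 2"
proof -
  define r where "r i j = c1 i + c1 j - c2 i j" for i j
  have r: "r i j \<le> c1 i" "r i j \<le> c1 j" "r i i = c1 i" "r i j = r j i" for i j
    using c2(1)[of i] c2(2)[of i j] c2(2)[of j i] c2(3)[of i j] by (auto simp: r_def)
  have lam0_pos: "0 < lam0 $ i" for i using lam0(1)[of i] \<open>0 < a\<close> by simp
  obtain Q where Q: "\<And>i. Q i = (\<Sum>j\<in>UNIV. lam0 $ j / \<theta>0 * max 0 (r i j - Q i - Q j))"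
    using price_equilibrium_exists[of "\<lambda>i. lam0 $ i / \<theta>0" r] lam0_pos \<open>0 < \<theta>0\<close>
    by (auto simp: less_imp_le)
  define t where "t i j = max 0 (r i j - Q i - Q j)" for i j
  \<comment> \<open>Ties count as edges, so the weak inequality \<open>2 * Q i \<le> c1 i\<close> is
    enough for the loops.\<close>
  define E where "E i j \<longleftrightarrow> 0 \<le> r i j - Q i - Q j" for i j
  have Q0: "0 \<le> Q i" for i
    using lam0_pos \<open>0 < \<theta>0\<close> by (subst Q) (auto intro!: sum_nonneg mult_nonneg_nonneg simp: less_imp_le)
  have t: "0 \<le> t i j" "t i j \<le> sum c1 UNIV" for i j
  proof -
    have "t i j \<le> c1 i"
      using Q0[of i] Q0[of j] r(1)[of i j] c1[of i] by (simp add: t_def)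
    also have "\<dots> \<le> sum c1 UNIV"
      by (rule member_le_sum) (auto intro: less_imp_le c1)
    finally show "t i j \<le> sum c1 UNIV" .
  qed (simp add: t_def)
  have "symp E"
    by (auto simp: symp_def E_def r(4) algebra_simps)
  have "2 * Q i \<le> c1 i" for i
    by (rule price_equilibrium_le_half[OF _ card c1 r(1-3) Q]) (simp add: lam0_pos \<open>0 < \<theta>0\<close>)
  then have "reflp E"
    by (auto simp: reflp_def E_def r(3))
  have sol: "\<exists>v. (\<forall>i. sat_op E (\<lambda>i. lam $ i / \<theta>0) v i = 1) \<and> (\<forall>i. 0 \<le> v i) \<and> (\<forall>i. v i \<le> 1) \<and>
      lp_value c1 c2 (\<lambda>_. \<theta>0) lam \<le> (\<Sum>i\<in>UNIV. lam $ i * (c1 i - Q i))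
        - (\<Sum>i\<in>UNIV. lam $ i * v i * ((\<Sum>j\<in>UNIV. lam $ j / \<theta>0 * t i j) - Q i))"
    if lam: "\<forall>i. 0 < lam $ i" for lam
  proof -
    have \<mu>: "0 < lam $ i / \<theta>0" for i using lam \<open>0 < \<theta>0\<close> by simp
    obtain v where v: "\<And>i. sat_op E (\<lambda>i. lam $ i / \<theta>0) v i = 1"
      using sat_op_solvable[of E "\<lambda>i. lam $ i / \<theta>0" "\<lambda>_. 1"] \<open>symp E\<close> \<mu> by blast
    have v0: "0 \<le> v i" for i
      by (rule sat_op_nonneg[OF \<open>reflp E\<close> \<open>symp E\<close> \<mu> card v])
    have v1: "v i \<le> 1" for i
      by (rule sat_op_le_one[OF less_imp_le[OF \<mu>] v0 v])
    let ?z = "(\<lambda>i j. of_bool (E i j) * (lam $ i * lam $ j * v i / \<theta>0), \<lambda>i. lam $ i * v i)"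
    have feas: "?z \<in> lp_feasible (\<lambda>_. \<theta>0) lam"
      using lam by (intro saturated_feasible \<open>0 < \<theta>0\<close> \<open>symp E\<close> v0 v) (auto simp: less_imp_le)
    have "bdd_below (lp_objective c1 c2 ` lp_feasible (\<lambda>_. \<theta>0) lam)"
      using c1 c2(2) by (intro lp_objective_bdd_below) (meson less_imp_le order_trans)+
    then have "lp_value c1 c2 (\<lambda>_. \<theta>0) lam \<le> lp_objective c1 c2 ?z"
      unfolding lp_value_def using feas by (rule cINF_lower)
    also have "\<dots> = (\<Sum>i\<in>UNIV. lam $ i * (c1 i - Q i))
        - (\<Sum>i\<in>UNIV. lam $ i * v i * ((\<Sum>j\<in>UNIV. lam $ j / \<theta>0 * t i j) - Q i))"
      using saturated_objective[OF feas, of c1 c2 Q] by (simp only: E_def t_def r_def)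
    finally show ?thesis using v v0 v1 by blast
  qed
  obtain w where w: "\<And>i. sat_op E (\<lambda>i. lam0 $ i / \<theta>0) w i = 1" "\<And>i. 0 \<le> w i" "\<And>i. w i \<le> 1"
    using sol[of lam0] lam0_pos by blast
  have dual: "(\<Sum>i\<in>UNIV. lam0 $ i * (c1 i - Q i)) \<le> lp_value c1 c2 (\<lambda>_. \<theta>0) lam0"
    unfolding lp_value_def
  proof (rule cINF_greatest)
    show "lp_feasible (\<lambda>_. \<theta>0) lam0 \<noteq> {}"
      using lp_feasible_nonempty lam0_pos less_imp_le by blast
    show "(\<Sum>i\<in>UNIV. lam0 $ i * (c1 i - Q i)) \<le> lp_objective c1 c2 z"
      if "z \<in> lp_feasible (\<lambda>_. \<theta>0) lam0" for z
      using that lp_objective_ge_price[OF \<open>0 < \<theta>0\<close>, of "fst z" "snd z" lam0 Q c1 c2] Q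
      by (simp add: r_def)
  qed
  \<comment> \<open>This is the gradient in \<open>lam\<close> of the price sum minus the residuals,
    with the weights fixed at \<open>lam0 $ i * w i\<close>.\<close>
  define g :: "real^'n" where "g = (\<chi> j. c1 j - Q j - (\<Sum>i\<in>UNIV. lam0 $ i * w i * t i j) / \<theta>0)"
  have "lp_value c1 c2 (\<lambda>_. \<theta>0) lam
      \<le> lp_value c1 c2 (\<lambda>_. \<theta>0) lam0 + g \<bullet> (lam - lam0) + \<rho> * (norm (lam - lam0))\<^sup>2 / 2"
    if lam: "\<forall>i. a \<le> lam $ i \<and> lam $ i \<le> b" for lam
  proof -
    define d where "d = norm (lam - lam0)"
    have \<Delta>: "\<bar>lam $ i - lam0 $ i\<bar> \<le> d" for i
      using component_le_norm_cart[of "lam - lam0" i] by (simp add: d_def)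
    have lam_pos: "0 < lam $ i" for i using lam \<open>0 < a\<close> by (meson less_le_trans)
    then obtain v where v: "\<And>i. sat_op E (\<lambda>i. lam $ i / \<theta>0) v i = 1" "\<And>i. 0 \<le> v i" "\<And>i. v i \<le> 1"
      and le: "lp_value c1 c2 (\<lambda>_. \<theta>0) lam \<le> (\<Sum>i\<in>UNIV. lam $ i * (c1 i - Q i))
        - (\<Sum>i\<in>UNIV. lam $ i * v i * ((\<Sum>j\<in>UNIV. lam $ j / \<theta>0 * t i j) - Q i))"
      using sol[of lam] by blast
    have lip: "\<bar>v i - w i\<bar> \<le> L * d" for i
    proof -
      have "\<bar>v i - w i\<bar> \<le> sqrt (CARD('n) * (b / \<theta>0) / (a / \<theta>0)) * (2 * CARD('n) * (d / \<theta>0))"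
        using \<open>0 < \<theta>0\<close> \<open>0 < a\<close> lam \<Delta>
        by (intro sat_op_solution_Lipschitz[OF \<open>symp E\<close> _ _ _ w v(1)])
           (auto simp: diff_divide_distrib[symmetric] divide_right_mono)
      then show ?thesis by (simp add: L_def)
    qed
    have y: "\<bar>lam $ i * v i - lam0 $ i * w i\<bar> \<le> (b * L + 1) * d" for i
    proof -
      have "\<bar>lam $ i * (v i - w i)\<bar> \<le> b * (L * d)"
        unfolding abs_mult using lip[of i] lam lam_pos[of i]
        by (intro mult_mono) (auto intro: order_trans[OF less_imp_le])
      moreover have "\<bar>(lam $ i - lam0 $ i) * w i\<bar> \<le> d * 1"
        unfolding abs_mult using \<Delta>[of i] w(2,3)[of i] by (intro mult_mono) auto
      moreover have "lam $ i * v i - lam0 $ i * w i = lam $ i * (v i - w i) + (lam $ i - lam0 $ i) * w i"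
        by (simp add: algebra_simps)
      ultimately show ?thesis by (simp add: algebra_simps)
    qed
    \<comment> \<open>\<open>Q\<close> solves the price equation at \<open>lam0\<close>, so only the
      increment of \<open>lam\<close> survives.\<close>
    have row: "(\<Sum>j\<in>UNIV. lam $ j / \<theta>0 * t i j) - Q i = (\<Sum>j\<in>UNIV. (lam $ j - lam0 $ j) * t i j) / \<theta>0" for i
      by (subst Q) (simp add: t_def[symmetric] sum_subtractf[symmetric] sum_divide_distrib diff_divide_distrib left_diff_distrib)
    define z where "z i = (\<Sum>j\<in>UNIV. (lam $ j - lam0 $ j) * t i j) / \<theta>0" for i
    have z: "\<bar>z i\<bar> \<le> CARD('n) * (d * sum c1 UNIV) / \<theta>0" for i
    proof -
      have "\<bar>\<Sum>j\<in>UNIV. (lam $ j - lam0 $ j) * t i j\<bar> \<le> (\<Sum>j\<in>UNIV. \<bar>(lam $ j - lam0 $ j) * t i j\<bar>)"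
        by (rule sum_abs)
      also have "\<dots> \<le> (\<Sum>j\<in>(UNIV::'n set). d * sum c1 UNIV)"
        unfolding abs_mult using \<Delta> t by (intro sum_mono mult_mono) (auto simp: d_def)
      finally show ?thesis
        using \<open>0 < \<theta>0\<close> by (simp add: z_def divide_right_mono)
    qed
    have "\<bar>\<Sum>i\<in>UNIV. (lam $ i * v i - lam0 $ i * w i) * z i\<bar> \<le> (\<Sum>i\<in>UNIV. \<bar>(lam $ i * v i - lam0 $ i * w i) * z i\<bar>)"
      by (rule sum_abs)
    also have "\<dots> \<le> (\<Sum>i\<in>(UNIV::'n set). ((b * L + 1) * d) * (CARD('n) * (d * sum c1 UNIV) / \<theta>0))"
      unfolding abs_mult using y z by (intro sum_mono mult_mono) (auto intro: order_trans[OF abs_ge_zero])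
    also have "\<dots> = \<rho> * d\<^sup>2 / 2"
      by (simp add: \<rho>_def power2_eq_square)
    finally have err: "- (\<Sum>i\<in>UNIV. (lam $ i * v i - lam0 $ i * w i) * z i) \<le> \<rho> * d\<^sup>2 / 2"
      by simp
    have "(\<Sum>j\<in>UNIV. (\<Sum>i\<in>UNIV. lam0 $ i * w i * t i j) / \<theta>0 * (lam $ j - lam0 $ j)) = (\<Sum>i\<in>UNIV. lam0 $ i * w i * z i)"
      unfolding z_def sum_distrib_left sum_distrib_right sum_divide_distrib
      by (subst sum.swap) (simp add: mult_ac)
    then have "g \<bullet> (lam - lam0) = (\<Sum>i\<in>UNIV. lam $ i * (c1 i - Q i)) - (\<Sum>i\<in>UNIV. lam0 $ i * (c1 i - Q i))
        - (\<Sum>i\<in>UNIV. lam0 $ i * w i * z i)"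
      by (simp add: inner_vec_def g_def left_diff_distrib right_diff_distrib sum_subtractf mult.commute)
    with le dual err show ?thesis
      unfolding row z_def[symmetric] d_def[symmetric]
      by (simp add: left_diff_distrib sum_subtractf)
  qed
  then show ?thesis by blast
qed

theorem corollary1:
  fixes c1 :: "'n::finite \<Rightarrow> real"
    and c2 :: "'n \<Rightarrow> 'n \<Rightarrow> real"
    and \<theta> :: "'n \<Rightarrow> real"
    and \<theta>0 :: real
    and lo hi :: "real ^ 'n"
  assumes "\<And>i. 0 < c1 i"
    and "\<And>i j. 0 < c2 i j"
    and "\<And>i. c1 i = c2 i i"
    and "\<And>i j. c1 i \<le> c2 i j"
    and "\<And>i j. c2 i j = c2 j i"
    and "\<And>i. 0 < \<theta> i"
    and "\<And>i. 0 < lo $ i"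
    and "CARD('n) \<le> 3"
    and "\<And>i. \<theta> i = \<theta>0"
  shows "weakly_concave_on {lam. \<forall>i. lo $ i \<le> lam $ i \<and> lam $ i \<le> hi $ i} (lp_value c1 c2 \<theta>)"
proof -
  have \<theta>: "\<theta> = (\<lambda>_. \<theta>0)" and "0 < \<theta>0"
    using assms(6,9) by auto
  \<comment> \<open>One cube for all coordinates gives a single \<open>\<rho>\<close> for the whole
    box. \<open>norm hi\<close> is nonnegative even for an empty box, and
    \<open>0 \<le> \<rho>\<close> is derived from that.\<close>
  define a b where "a = Min (range (($) lo))" and "b = norm hi"
  define L where "L = sqrt (CARD('n) * (b / \<theta>0) / (a / \<theta>0)) * (2 * CARD('n) / \<theta>0)"
  define \<rho> where "\<rho> = 2 * ((CARD('n))\<^sup>2 * (b * L + 1) * sum c1 UNIV / \<theta>0)"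
  have "0 < a" and a: "a \<le> lo $ i" for i
    using assms(7) by (auto simp: a_def)
  have b: "hi $ i \<le> b" for i
    using component_le_norm_cart[of hi i] by (simp add: b_def)
  have "0 \<le> b" by (simp add: b_def)
  then have "0 \<le> \<rho>"
    unfolding \<rho>_def L_def using \<open>0 < a\<close> \<open>0 < \<theta>0\<close> assms(1)
    by (intro mult_nonneg_nonneg divide_nonneg_nonneg add_nonneg_nonneg sum_nonneg) (auto simp: less_imp_le)
  have "concave_on (cbox lo hi) (\<lambda>v. lp_value c1 c2 \<theta> v - \<rho> * (norm v)\<^sup>2 / 2)"
  proof (rule concave_on_of_quadratic_support)
    fix x assume "x \<in> cbox lo hi"
    then have x: "a \<le> x $ i" "x $ i \<le> b" for i
      using a[of i] b[of i] by (auto simp: mem_box_cart intro: order_trans)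
    have "\<exists>g. \<forall>y. (\<forall>i. a \<le> y $ i \<and> y $ i \<le> b) \<longrightarrow>
        lp_value c1 c2 \<theta> y \<le> lp_value c1 c2 \<theta> x + g \<bullet> (y - x) + \<rho> * (norm (y - x))\<^sup>2 / 2"
      unfolding \<theta> \<rho>_def L_def
      by (rule lp_value_quadratic_support[OF assms(1) assms(3)[symmetric] assms(4,5) \<open>0 < \<theta>0\<close> assms(8) \<open>0 < a\<close> x])
    moreover have "\<forall>i. a \<le> y $ i \<and> y $ i \<le> b" if "y \<in> cbox lo hi" for y
      using that a b by (meson mem_box_cart(2) order_trans)
    ultimately show "\<exists>g. \<forall>y\<in>cbox lo hi.
        lp_value c1 c2 \<theta> y \<le> lp_value c1 c2 \<theta> x + g \<bullet> (y - x) + \<rho> * (norm (y - x))\<^sup>2 / 2"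
      by blast
  qed (rule convex_box)
  moreover have "cbox lo hi = {lam. \<forall>i. lo $ i \<le> lam $ i \<and> lam $ i \<le> hi $ i}"
    by (auto simp: mem_box_cart)
  ultimately show ?thesis
    unfolding weakly_concave_on_def using \<open>0 \<le> \<rho>\<close> by auto
qed

end
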